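(* Let $M$ be an $n$-dimensional $C^\infty$ manifold and consider a non-degenerate stochastic differential equation $dx_t = X(x_t)\circ dB_t + A(x_t)\,dt$ on $M$, with $X(x)\in\mathcal{L}(\mathbb{R}^m;T_xM)$ surjective for every $x\in M$. Then there is a unique affine connection $\tilde\nabla$ on $M$ such that for every $x\in M$, $$(\tilde\nabla X^e)(v)=0\qquad\text{for all } v\in T_xM,\ e\in[\ker X(x)]^\perp .$$ It is given by $\tilde\nabla Z(v)=\breve\nabla Z(v)$, where for every smooth vector field $Z$ on $M$, every $x \in M$ and $v\in T_xM$, $$\breve\nabla Z(v)=X(x)\big(d[Y(\cdot)Z(\cdot)](v)\big),$$ with $Y(x):T_xM\to\mathbb{R}^m$ the adjoint of $X(x)$. Moreover this connection is metric, i.e. compatible with the Riemannian metric induced on $M$ by $X$.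
   Context: $A$ is a $C^\infty$ vector field on $M$; $X(x):\mathbb{R}^m\to T_xM$ is linear for each $x$ and $C^\infty$ in $x$; $B$ is a Brownian motion on $\mathbb{R}^m$. For $e\in\mathbb{R}^m$, $X^e$ is the vector field $X^e(x)=X(x)(e)$. The induced Riemannian metric $\langle\cdot,\cdot\rangle_x$ on $T_xM$ is the one for which $X(x)$ restricted to $[\ker X(x)]^\perp$ is an isometry onto $T_xM$; adjoints are taken with respect to it and the Euclidean inner product on $\mathbb{R}^m$. For a connection $\tilde\nabla$ and a vector field $Z$, $\tilde\nabla Z(v)$ means $\tilde\nabla_vZ$. The map $Y(\cdot)Z(\cdot):M\to\mathbb{R}^m$, $x\mapsto Y(x)Z(x)$, is $\mathbb{R}^m$-valued and $d$ is its ordinary differential. *)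

theory Defs
  imports
    "HOL-Analysis.Analysis"
    "HOL-Probability.Probability"
    "HOL-Library.Function_Algebras"
begin

section \<open>Functions into a vector space form a vector space\<close>

instantiation "fun" :: (type, scaleR) scaleR
begin
definition scaleR_fun_def: "scaleR r f = (\<lambda>x. r *\<^sub>R f x)"
instance ..
end

lemma scaleR_fun_apply [simp]: "(r *\<^sub>R f) x = r *\<^sub>R f x"
  by (simp add: scaleR_fun_def)

instance "fun" :: (type, real_vector) real_vector
  by standard (simp_all add: fun_eq_iff scaleR_add_right scaleR_add_left)


section \<open>Infinitely differentiable maps between Euclidean spaces\<close>

text \<open>Used for open \<open>S\<close> in a finite-dimensional space only; there, continuity of all iterated
  directional derivatives is the same as being of class C-k.\<close>

fun Ck_on :: "nat \<Rightarrow> 'b::euclidean_space set \<Rightarrow> ('b \<Rightarrow> 'c::euclidean_space) \<Rightarrow> bool" where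
  "Ck_on 0 S f \<longleftrightarrow> continuous_on S f"
| "Ck_on (Suc k) S f \<longleftrightarrow> (\<forall>x\<in>S. f differentiable (at x)) \<and>
     (\<forall>v. Ck_on k S (\<lambda>x. frechet_derivative f (at x) v))"

definition smooth_on :: "'b::euclidean_space set \<Rightarrow> ('b \<Rightarrow> 'c::euclidean_space) \<Rightarrow> bool" where
  "smooth_on S f \<longleftrightarrow> (\<forall>k. Ck_on k S f)"


section \<open>Smooth manifolds\<close>

text \<open>A chart is a pair \<open>(U, \<phi>)\<close>; the values of \<open>\<phi>\<close> outside \<open>U\<close> carry no information.\<close>

type_synonym ('a, 'n) chart = "'a set \<times> ('a \<Rightarrow> real ^ 'n)"

abbreviation chart_dom :: "('a, 'n) chart \<Rightarrow> 'a set" where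
  "chart_dom c \<equiv> fst c"

abbreviation chart_map :: "('a, 'n) chart \<Rightarrow> 'a \<Rightarrow> real ^ 'n" where
  "chart_map c \<equiv> snd c"

abbreviation chart_inv :: "('a, 'n) chart \<Rightarrow> real ^ 'n \<Rightarrow> 'a" where
  "chart_inv c \<equiv> inv_into (chart_dom c) (chart_map c)"

definition is_chart :: "'a topology \<Rightarrow> ('a, 'n::finite) chart \<Rightarrow> bool" where
  "is_chart M c \<longleftrightarrow> openin M (chart_dom c) \<and> open (chart_map c ` chart_dom c) \<and>
     homeomorphic_map (subtopology M (chart_dom c)) (top_of_set (chart_map c ` chart_dom c))
       (chart_map c)"

definition carrier_set :: "('a, 'n) chart set \<Rightarrow> 'a set" where
  "carrier_set \<A> = (\<Union>c\<in>\<A>. chart_dom c)"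

text \<open>The smooth structure is given by an atlas, which may but need not be maximal; all notions
  below are unchanged when compatible charts are added.  The dimension is \<open>CARD('n)\<close>.\<close>

definition smooth_manifold :: "'a topology \<Rightarrow> ('a, 'n::finite) chart set \<Rightarrow> bool" where
  "smooth_manifold M \<A> \<longleftrightarrow>
     Hausdorff_space M \<and> second_countable M \<and>
     (\<forall>c\<in>\<A>. is_chart M c) \<and> carrier_set \<A> = topspace M \<and>
     (\<forall>c\<in>\<A>. \<forall>d\<in>\<A>. smooth_on (chart_map c ` (chart_dom c \<inter> chart_dom d))
        (chart_map d \<circ> chart_inv c))"

definition charts_at :: "('a, 'n) chart set \<Rightarrow> 'a \<Rightarrow> ('a, 'n) chart set" where
  "charts_at \<A> x = {c \<in> \<A>. x \<in> chart_dom c}"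

definition smooth_map ::
  "('a, 'n::finite) chart set \<Rightarrow> ('a \<Rightarrow> 'b::euclidean_space) \<Rightarrow> bool" where
  "smooth_map \<A> f \<longleftrightarrow> (\<forall>c\<in>\<A>. smooth_on (chart_map c ` chart_dom c) (f \<circ> chart_inv c))"


section \<open>Tangent vectors, differentials, vector fields\<close>

text \<open>A tangent vector at \<open>x\<close> is its family of coordinate vectors: it assigns to every chart around
  \<open>x\<close> a vector in \<open>\<real>\<^sup>n\<close>, and these are related by the derivatives of the transition maps.  Charts
  not around \<open>x\<close> are sent to 0, so that the tangent space is a linear subspace of the function
  space \<open>tvec\<close>.  The base point is not part of the vector and is passed separately below.\<close>

type_synonym ('a, 'n) tvec = "('a, 'n) chart \<Rightarrow> real ^ 'n"

definition tangent_space :: "('a, 'n::finite) chart set \<Rightarrow> 'a \<Rightarrow> ('a, 'n) tvec set" where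
  "tangent_space \<A> x = {v.
     (\<forall>c. c \<notin> charts_at \<A> x \<longrightarrow> v c = 0) \<and>
     (\<forall>c\<in>charts_at \<A> x. \<forall>d\<in>charts_at \<A> x.
        v d = frechet_derivative (chart_map d \<circ> chart_inv c) (at (chart_map c x)) (v c))}"

text \<open>The differential is computed in an arbitrary chart; by the chain rule the choice is
  irrelevant for tangent vectors and functions that are differentiable at \<open>x\<close>.\<close>

definition differential ::
  "('a, 'n::finite) chart set \<Rightarrow> ('a \<Rightarrow> 'b::euclidean_space) \<Rightarrow> 'a \<Rightarrow> ('a, 'n) tvec \<Rightarrow> 'b" where
  "differential \<A> f x v = (let c = (SOME c. c \<in> charts_at \<A> x) in
     frechet_derivative (f \<circ> chart_inv c) (at (chart_map c x)) (v c))"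

definition smooth_vector_field ::
  "('a, 'n::finite) chart set \<Rightarrow> ('a \<Rightarrow> ('a, 'n) tvec) \<Rightarrow> bool" where
  "smooth_vector_field \<A> Z \<longleftrightarrow>
     (\<forall>x\<in>carrier_set \<A>. Z x \<in> tangent_space \<A> x) \<and>
     (\<forall>c\<in>\<A>. smooth_on (chart_map c ` chart_dom c) (\<lambda>p. Z (chart_inv c p) c))"


section \<open>Affine connections and Riemannian metrics\<close>

text \<open>\<open>D Z x v\<close> is the covariant derivative of \<open>Z\<close> in the direction of the tangent vector \<open>v\<close> at
  \<open>x\<close>.  The last clause fixes the value 0 for meaningless arguments, so that two connections are
  equal as functions iff they agree on smooth fields and tangent vectors.  Values of \<open>Z\<close> outside
  the manifold are immaterial: by the Leibniz rule with \<open>f = 0\<close> on the manifold, a field that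
  vanishes there has derivative 0.\<close>

type_synonym ('a, 'n) covder =
  "('a \<Rightarrow> ('a, 'n) tvec) \<Rightarrow> 'a \<Rightarrow> ('a, 'n) tvec \<Rightarrow> ('a, 'n) tvec"

definition affine_connection ::
  "('a, 'n::finite) chart set \<Rightarrow> ('a, 'n) covder \<Rightarrow> bool" where
  "affine_connection \<A> D \<longleftrightarrow>
     (\<forall>Z x v. smooth_vector_field \<A> Z \<and> x \<in> carrier_set \<A> \<and> v \<in> tangent_space \<A> x \<longrightarrow>
        D Z x v \<in> tangent_space \<A> x) \<and>
     (\<forall>Z x u v a b. smooth_vector_field \<A> Z \<and> x \<in> carrier_set \<A> \<and>
        u \<in> tangent_space \<A> x \<and> v \<in> tangent_space \<A> x \<longrightarrow>
        D Z x (a *\<^sub>R u + b *\<^sub>R v) = a *\<^sub>R D Z x u + b *\<^sub>R D Z x v) \<and>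
     (\<forall>Z W x v. smooth_vector_field \<A> Z \<and> smooth_vector_field \<A> W \<and>
        x \<in> carrier_set \<A> \<and> v \<in> tangent_space \<A> x \<longrightarrow>
        D (\<lambda>y. Z y + W y) x v = D Z x v + D W x v) \<and>
     (\<forall>(f :: 'a \<Rightarrow> real) Z x v. smooth_map \<A> f \<and> smooth_vector_field \<A> Z \<and>
        x \<in> carrier_set \<A> \<and> v \<in> tangent_space \<A> x \<longrightarrow>
        D (\<lambda>y. f y *\<^sub>R Z y) x v = differential \<A> f x v *\<^sub>R Z x + f x *\<^sub>R D Z x v) \<and>
     (\<forall>Z V. smooth_vector_field \<A> Z \<and> smooth_vector_field \<A> V \<longrightarrow>
        smooth_vector_field \<A> (\<lambda>x. D Z x (V x))) \<and>
     (\<forall>Z x v. \<not> (smooth_vector_field \<A> Z \<and> x \<in> carrier_set \<A> \<and> v \<in> tangent_space \<A> x) \<longrightarrow>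
        D Z x v = 0)"

type_synonym ('a, 'n) metric_field = "'a \<Rightarrow> ('a, 'n) tvec \<Rightarrow> ('a, 'n) tvec \<Rightarrow> real"

definition riemannian_metric ::
  "('a, 'n::finite) chart set \<Rightarrow> ('a, 'n) metric_field \<Rightarrow> bool" where
  "riemannian_metric \<A> g \<longleftrightarrow>
     (\<forall>x\<in>carrier_set \<A>. \<forall>u\<in>tangent_space \<A> x. \<forall>v\<in>tangent_space \<A> x. \<forall>w\<in>tangent_space \<A> x.
        \<forall>a b. g x (a *\<^sub>R u + b *\<^sub>R v) w = a * g x u w + b * g x v w) \<and>
     (\<forall>x\<in>carrier_set \<A>. \<forall>u\<in>tangent_space \<A> x. \<forall>v\<in>tangent_space \<A> x. g x u v = g x v u) \<and>
     (\<forall>x\<in>carrier_set \<A>. \<forall>u\<in>tangent_space \<A> x. u \<noteq> 0 \<longrightarrow> g x u u > 0) \<and>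
     (\<forall>Z W. smooth_vector_field \<A> Z \<and> smooth_vector_field \<A> W \<longrightarrow>
        smooth_map \<A> (\<lambda>x. g x (Z x) (W x)))"

definition metric_connection ::
  "('a, 'n::finite) chart set \<Rightarrow> ('a, 'n) metric_field \<Rightarrow> ('a, 'n) covder \<Rightarrow> bool" where
  "metric_connection \<A> g D \<longleftrightarrow> riemannian_metric \<A> g \<and> affine_connection \<A> D \<and>
     (\<forall>Z W x v. smooth_vector_field \<A> Z \<and> smooth_vector_field \<A> W \<and>
        x \<in> carrier_set \<A> \<and> v \<in> tangent_space \<A> x \<longrightarrow>
        differential \<A> (\<lambda>y. g y (Z y) (W y)) x v =
          g x (D Z x v) (W x) + g x (Z x) (D W x v))"


section \<open>Brownian motion and the coefficients of the equation\<close>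

definition brownian_motion :: "'w measure \<Rightarrow> (real \<Rightarrow> 'w \<Rightarrow> real ^ 'm::finite) \<Rightarrow> bool" where
  "brownian_motion P B \<longleftrightarrow> prob_space P \<and>
     (\<forall>t\<ge>0. B t \<in> borel_measurable P) \<and>
     (AE \<omega> in P. B 0 \<omega> = 0) \<and>
     (AE \<omega> in P. continuous_on {0..} (\<lambda>t. B t \<omega>)) \<and>
     (\<forall>(k::nat) t. 0 \<le> t 0 \<and> strict_mono_on {..k} t \<longrightarrow>
        prob_space.indep_vars P (\<lambda>_. borel) (\<lambda>i \<omega>. B (t (Suc i)) \<omega> - B (t i) \<omega>) {..<k}) \<and>
     (\<forall>s t. 0 \<le> s \<and> s < t \<longrightarrow>
        distributed P lborel (\<lambda>\<omega>. B t \<omega> - B s \<omega>)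
          (\<lambda>z. ennreal (\<Prod>i\<in>UNIV. normal_density 0 (sqrt (t - s)) (z $ i))))"

definition smooth_coefficient ::
  "('a, 'n::finite) chart set \<Rightarrow> ('a \<Rightarrow> real ^ 'm::finite \<Rightarrow> ('a, 'n) tvec) \<Rightarrow> bool" where
  "smooth_coefficient \<A> X \<longleftrightarrow>
     (\<forall>x\<in>carrier_set \<A>. linear (X x)) \<and> (\<forall>e. smooth_vector_field \<A> (\<lambda>x. X x e))"

text \<open>\<open>X\<close>, \<open>A\<close> and \<open>B\<close> are the data of the equation \<open>dx = X(x) \<circ> dB + A(x) dt\<close> on the manifold;
  non-degeneracy is surjectivity of every \<open>X x\<close> onto the tangent space.\<close>

definition nondegenerate_sde ::
  "('a, 'n::finite) chart set \<Rightarrow> ('a \<Rightarrow> real ^ 'm::finite \<Rightarrow> ('a, 'n) tvec) \<Rightarrow>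
    ('a \<Rightarrow> ('a, 'n) tvec) \<Rightarrow> 'w measure \<Rightarrow> (real \<Rightarrow> 'w \<Rightarrow> real ^ 'm) \<Rightarrow> bool" where
  "nondegenerate_sde \<A> X A P B \<longleftrightarrow>
     smooth_coefficient \<A> X \<and> smooth_vector_field \<A> A \<and> brownian_motion P B \<and>
     (\<forall>x\<in>carrier_set \<A>. X x ` UNIV = tangent_space \<A> x)"


section \<open>The induced metric, the adjoint, and the connection\<close>

definition ker_perp :: "('a \<Rightarrow> real ^ 'm::finite \<Rightarrow> ('a, 'n::finite) tvec) \<Rightarrow> 'a \<Rightarrow> (real ^ 'm) set" where
  "ker_perp X x = {e. X x e = 0}\<^sup>\<bottom>"

text \<open>Inner product of the unique preimages in the orthogonal complement of the kernel, i.e. the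
  metric that makes the restriction of \<open>X x\<close> to that complement an isometry.\<close>

definition induced_metric ::
  "('a \<Rightarrow> real ^ 'm::finite \<Rightarrow> ('a, 'n::finite) tvec) \<Rightarrow> ('a, 'n) metric_field" where
  "induced_metric X x u v = inv_into (ker_perp X x) (X x) u \<bullet> inv_into (ker_perp X x) (X x) v"

definition adjoint_coefficient ::
  "('a \<Rightarrow> real ^ 'm::finite \<Rightarrow> ('a, 'n::finite) tvec) \<Rightarrow> 'a \<Rightarrow> ('a, 'n) tvec \<Rightarrow> real ^ 'm" where
  "adjoint_coefficient X x u = (THE y. \<forall>e. y \<bullet> e = induced_metric X x u (X x e))"

definition breve_nabla ::
  "('a, 'n::finite) chart set \<Rightarrow> ('a \<Rightarrow> real ^ 'm::finite \<Rightarrow> ('a, 'n) tvec) \<Rightarrow> ('a, 'n) covder" where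
  "breve_nabla \<A> X Z x v =
     X x (differential \<A> (\<lambda>y. adjoint_coefficient X y (Z y)) x v)"

definition adapted_connection ::
  "('a, 'n::finite) chart set \<Rightarrow> ('a \<Rightarrow> real ^ 'm::finite \<Rightarrow> ('a, 'n) tvec) \<Rightarrow>
    ('a, 'n) covder \<Rightarrow> bool" where
  "adapted_connection \<A> X D \<longleftrightarrow> affine_connection \<A> D \<and>
     (\<forall>x\<in>carrier_set \<A>. \<forall>v\<in>tangent_space \<A> x. \<forall>e\<in>ker_perp X x. D (\<lambda>y. X y e) x v = 0)"

end

theory Submission
  imports Defs
begin

text \<open>Let \<open>Y x\<close> be the inverse of \<open>X x\<close> on the orthogonal complement of its kernel; it is the adjoint of
  \<open>X x\<close>.  Every field is the global combination \<open>Z = (\<Sum>i. f i X\<^sup>i)\<close> of the fields \<open>X\<^sup>i = X(e\<^sub>i)\<close>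
  with smooth coefficients \<open>f = Y Z\<close>.  For an adapted connection \<open>D\<close> the Leibniz rule gives
  \<open>D Z v = (\<Sum>i. df i(v) X\<^sup>i) + (\<Sum>i. f i(x) D X\<^sup>i v)\<close>; the second sum is the derivative of \<open>X\<^sup>e\<close> for
  \<open>e = Y(x) Z(x)\<close>, which is orthogonal to the kernel of \<open>X x\<close>, so it vanishes and
  \<open>D Z v = X(d(Y Z)(v))\<close>.  This formula defines a metric connection because \<open>X x\<close> and \<open>Y x\<close> are
  adjoint, and it is adapted because \<open>Y X\<close> is a field of orthogonal projections.\<close>

section \<open>Calculus of smooth maps\<close>

text \<open>\<open>frechet_derivative\<close> looks at a full neighbourhood of a point. Since
  \<open>S\<close> is open, agreement on \<open>S\<close> forces equal derivatives at its points,
  and this passes to all orders.\<close>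

lemma Ck_on_cong:
  assumes "open S" "Ck_on k S f" "\<And>x. x \<in> S \<Longrightarrow> f x = g x"
  shows "Ck_on k S g"
  using assms(2,3)
proof (induction k arbitrary: f g)
  case 0
  then show ?case by (auto cong: continuous_on_cong)
next
  case (Suc k)
  have 1: "frechet_derivative f (at x) = frechet_derivative g (at x)" if "x \<in> S" for x
    using Suc.prems that assms(1)
    by (intro frechet_derivative_transform_within_open[where X = S]) auto
  show ?case
    unfolding Ck_on.simps
  proof (intro conjI ballI allI)
    fix x assume "x \<in> S"
    then show "g differentiable at x"
      using Suc.prems assms(1) unfolding differentiable_def Ck_on.simps
      by (meson has_derivative_transform_within_open)
  next
    fix v
    show "Ck_on k S (\<lambda>x. frechet_derivative g (at x) v)"
      by (rule Suc.IH[of "\<lambda>x. frechet_derivative f (at x) v"]) (use Suc.prems 1 in auto)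
  qed
qed

text \<open>Derivatives are unique, so any explicit \<open>f'\<close> may replace
  \<open>frechet_derivative\<close>. The induction steps below then treat only the formula that a
  differentiation rule produces.\<close>

lemma Ck_on_SucI:
  assumes "open S" "\<And>x. x \<in> S \<Longrightarrow> (f has_derivative f' x) (at x)"
    and "\<And>v. Ck_on k S (\<lambda>x. f' x v)"
  shows "Ck_on (Suc k) S f"
  unfolding Ck_on.simps
proof (intro conjI ballI allI)
  fix x assume "x \<in> S"
  then show "f differentiable at x" using assms(2) by (auto simp: differentiable_def)
next
  fix v
  show "Ck_on k S (\<lambda>x. frechet_derivative f (at x) v)"
    by (rule Ck_on_cong[OF assms(1) assms(3)[of v]]) (metis assms(2) frechet_derivative_at)
qed

lemma Ck_on_has_derivative:
  "Ck_on (Suc k) S f \<Longrightarrow> x \<in> S \<Longrightarrow> (f has_derivative frechet_derivative f (at x)) (at x)"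
  by (simp add: frechet_derivative_works[symmetric])

text \<open>Supplies the lower order at which undifferentiated factors enter the product and
  reciprocal rules.\<close>

lemma Ck_on_SucD: "Ck_on (Suc k) S f \<Longrightarrow> Ck_on k S f"
proof (induction k arbitrary: f)
  case 0
  then show ?case
    by (auto simp: differentiable_imp_continuous_within continuous_at_imp_continuous_on)
next
  case (Suc k)
  then show ?case by (metis Ck_on.simps(2))
qed

lemma Ck_on_const: "Ck_on k S (\<lambda>x. c)"
  by (induction k arbitrary: c) auto

lemma Ck_on_bounded_linear:
  assumes "open S" "bounded_linear L" "Ck_on k S f"
  shows "Ck_on k S (\<lambda>x. L (f x))"
  using assms(3)
proof (induction k arbitrary: f)
  case 0
  then show ?case using assms(2) by (auto intro: bounded_linear.continuous_on)
next
  case (Suc k)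
  show ?case
    by (rule Ck_on_SucI[OF assms(1) bounded_linear.has_derivative[OF assms(2)
          Ck_on_has_derivative[OF Suc.prems]]]) (use Suc in auto)
qed

lemma Ck_on_add:
  assumes "open S" "Ck_on k S f" "Ck_on k S g"
  shows "Ck_on k S (\<lambda>x. f x + g x)"
  using assms(2,3)
proof (induction k arbitrary: f g)
  case 0
  then show ?case by (auto intro: continuous_on_add)
next
  case (Suc k)
  show ?case
    by (rule Ck_on_SucI[OF assms(1) has_derivative_add[OF
          Ck_on_has_derivative[OF Suc.prems(1)] Ck_on_has_derivative[OF Suc.prems(2)]]])
      (use Suc in auto)
qed

text \<open>The product rule yields two terms of the same shape \<open>h _ _\<close> with one order
  less, so the induction runs over all pairs \<open>f\<close>, \<open>g\<close>.\<close>

lemma Ck_on_bilinear: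
  assumes "open S" "bounded_bilinear h" "Ck_on k S f" "Ck_on k S g"
  shows "Ck_on k S (\<lambda>x. h (f x) (g x))"
  using assms(3,4)
proof (induction k arbitrary: f g)
  case 0
  then show ?case using bounded_bilinear.continuous_on[OF assms(2)] by auto
next
  case (Suc k)
  have D: "Ck_on k S (\<lambda>x. frechet_derivative f (at x) v)"
    "Ck_on k S (\<lambda>x. frechet_derivative g (at x) v)" for v
    using Suc.prems by auto
  show ?case
    by (rule Ck_on_SucI[OF assms(1) bounded_bilinear.FDERIV[OF assms(2)
          Ck_on_has_derivative[OF Suc.prems(1)] Ck_on_has_derivative[OF Suc.prems(2)]]])
      (assumption | intro Ck_on_add[OF assms(1)] Suc.IH D Suc.prems[THEN Ck_on_SucD])+
qed

text \<open>The derivative of the reciprocal is a product of the derivative of \<open>f\<close> with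
  two copies of the reciprocal itself, to which the induction hypothesis applies.\<close>

lemma Ck_on_inverse:
  fixes f :: "'b::euclidean_space \<Rightarrow> real"
  assumes "open S" "Ck_on k S f" "\<And>x. x \<in> S \<Longrightarrow> f x \<noteq> 0"
  shows "Ck_on k S (\<lambda>x. inverse (f x))"
  using assms(2,3)
proof (induction k arbitrary: f)
  case 0
  then show ?case by (auto intro: continuous_on_inverse)
next
  case (Suc k)
  have inv: "Ck_on k S (\<lambda>x. inverse (f x))"
    using Suc.IH[OF Ck_on_SucD[OF Suc.prems(1)] Suc.prems(2)] .
  have D: "Ck_on k S (\<lambda>x. frechet_derivative f (at x) v)" for v
    using Suc.prems(1) by simp
  have main: "Ck_on k S (\<lambda>x. - (inverse (f x) * frechet_derivative f (at x) v * inverse (f x)))" for v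
    by (intro Ck_on_bounded_linear[OF assms(1) bounded_linear_minus[OF bounded_linear_ident]]
        Ck_on_bilinear[OF assms(1) bounded_bilinear_mult] inv D)
  show ?case
    by (rule Ck_on_SucI[OF assms(1) Deriv.has_derivative_inverse[OF Suc.prems(2)
            Ck_on_has_derivative[OF Suc.prems(1)]]], assumption+) (rule main)
qed

lemma smooth_on_const: "smooth_on S (\<lambda>x. c)"
  by (simp add: smooth_on_def Ck_on_const)

lemma smooth_on_cong:
  "open S \<Longrightarrow> smooth_on S f \<Longrightarrow> (\<And>x. x \<in> S \<Longrightarrow> f x = g x) \<Longrightarrow> smooth_on S g"
  unfolding smooth_on_def using Ck_on_cong by blast

lemma smooth_on_has_derivative:
  "smooth_on S f \<Longrightarrow> x \<in> S \<Longrightarrow> (f has_derivative frechet_derivative f (at x)) (at x)"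
  unfolding smooth_on_def using Ck_on_has_derivative by blast

lemma smooth_on_bounded_linear:
  "open S \<Longrightarrow> bounded_linear L \<Longrightarrow> smooth_on S f \<Longrightarrow> smooth_on S (\<lambda>x. L (f x))"
  by (simp add: smooth_on_def Ck_on_bounded_linear)

lemma smooth_on_bilinear:
  "open S \<Longrightarrow> bounded_bilinear h \<Longrightarrow> smooth_on S f \<Longrightarrow> smooth_on S g \<Longrightarrow>
    smooth_on S (\<lambda>x. h (f x) (g x))"
  by (simp add: smooth_on_def Ck_on_bilinear)

lemma smooth_on_frechet_derivative:
  "smooth_on S f \<Longrightarrow> smooth_on S (\<lambda>x. frechet_derivative f (at x) v)"
  unfolding smooth_on_def by (metis Ck_on.simps(2))

lemma smooth_on_add:
  "open S \<Longrightarrow> smooth_on S f \<Longrightarrow> smooth_on S g \<Longrightarrow> smooth_on S (\<lambda>x. f x + g x)"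
  by (simp add: smooth_on_def Ck_on_add)

lemma smooth_on_divide:
  fixes f g :: "'b::euclidean_space \<Rightarrow> real"
  shows "open S \<Longrightarrow> smooth_on S f \<Longrightarrow> smooth_on S g \<Longrightarrow> (\<And>x. x \<in> S \<Longrightarrow> g x \<noteq> 0) \<Longrightarrow>
    smooth_on S (\<lambda>x. f x / g x)"
  unfolding divide_inverse
  by (simp add: smooth_on_def Ck_on_bilinear[OF _ bounded_bilinear_mult] Ck_on_inverse)

lemma smooth_on_sum:
  assumes "open S" "\<And>i. i \<in> I \<Longrightarrow> smooth_on S (f i)"
  shows "smooth_on S (\<lambda>x. \<Sum>i\<in>I. f i x)"
  using assms(2)
proof (induction I rule: infinite_finite_induct)
  case (insert i I)
  then show ?case using smooth_on_add[OF assms(1), of "f i"] by simp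
qed (simp_all add: smooth_on_const)

lemma smooth_on_prod:
  fixes f :: "'i \<Rightarrow> 'b::euclidean_space \<Rightarrow> real"
  assumes "open S" "\<And>i. i \<in> I \<Longrightarrow> smooth_on S (f i)"
  shows "smooth_on S (\<lambda>x. \<Prod>i\<in>I. f i x)"
  using assms(2)
proof (induction I rule: infinite_finite_induct)
  case (insert i I)
  then show ?case
    using smooth_on_bilinear[OF assms(1) bounded_bilinear_mult, of "f i"] by simp
qed (simp_all add: smooth_on_const)

section \<open>Linear systems with smooth coefficients\<close>

lemma basis_scaleR_expansion: "(\<Sum>i\<in>UNIV. w $ i *\<^sub>R axis i 1) = (w :: real ^ 'k)"
  by (simp add: vec_eq_iff axis_def if_distrib[where f = "(*) _"] cong: if_cong)

lemma smooth_on_vec: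
  fixes f :: "'b::euclidean_space \<Rightarrow> real ^ 'k"
  assumes "open S" "\<And>i. smooth_on S (\<lambda>x. f x $ i)"
  shows "smooth_on S f"
proof -
  have "smooth_on S (\<lambda>x. \<Sum>i\<in>UNIV. (f x $ i) *\<^sub>R axis i (1::real))"
    by (intro smooth_on_sum assms smooth_on_bilinear[OF _ bounded_bilinear_scaleR] smooth_on_const)
  then show ?thesis
    by (rule smooth_on_cong[OF assms(1)]) (rule basis_scaleR_expansion)
qed

text \<open>The determinant is a polynomial in the matrix entries.\<close>

lemma smooth_on_det:
  fixes G :: "'b::euclidean_space \<Rightarrow> real ^ 'k ^ 'k"
  assumes "open S" "\<And>i j. smooth_on S (\<lambda>x. G x $ i $ j)"
  shows "smooth_on S (\<lambda>x. det (G x))"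
  unfolding det_def
  by (intro smooth_on_sum smooth_on_prod smooth_on_bilinear[OF _ bounded_bilinear_mult]
      smooth_on_const assms)

text \<open>By Cramer's rule each component of the solution is a quotient of two determinants with
  smooth entries and nonvanishing denominator.\<close>

lemma smooth_on_linear_solution:
  fixes G :: "'b::euclidean_space \<Rightarrow> real ^ 'k ^ 'k"
  assumes "open S" "\<And>i j. smooth_on S (\<lambda>x. G x $ i $ j)" "smooth_on S b"
    and "\<And>x. x \<in> S \<Longrightarrow> det (G x) \<noteq> 0" "\<And>x. x \<in> S \<Longrightarrow> G x *v u x = b x"
  shows "smooth_on S u"
proof -
  have b: "smooth_on S (\<lambda>x. b x $ i)" for i
    by (rule smooth_on_bounded_linear[OF assms(1) bounded_linear_vec_nth assms(3)])
  have "smooth_on S (\<lambda>x. \<chi> k. det (\<chi> i j. if j = k then b x $ i else G x $ i $ j) / det (G x))"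
  proof (rule smooth_on_vec[OF assms(1)], simp, rule smooth_on_divide[OF assms(1)])
    fix k
    show "smooth_on S (\<lambda>x. det (\<chi> i j. if j = k then b x $ i else G x $ i $ j))"
    proof (rule smooth_on_det[OF assms(1)], simp)
      fix i j
      show "smooth_on S (\<lambda>x. if j = k then b x $ i else G x $ i $ j)"
        by (cases "j = k") (simp_all add: assms b)
    qed
  next
    show "smooth_on S (\<lambda>x. det (G x))"
      by (rule smooth_on_det[OF assms(1,2)])
  qed (rule assms(4))
  then show ?thesis
    by (rule smooth_on_cong[OF assms(1)])
      (rule iffD1[OF cramer[OF assms(4)] assms(5), symmetric])
qed

section \<open>Differentials and vector fields on a manifold\<close>

locale smooth_atlas =
  fixes M :: "'a topology" and \<A> :: "('a, 'n::finite) chart set"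
  assumes manifold: "smooth_manifold M \<A>"
begin

lemma carrier_topspace: "carrier_set \<A> = topspace M"
  using manifold by (simp add: smooth_manifold_def)

lemma chart_dom_carrier: "c \<in> \<A> \<Longrightarrow> x \<in> chart_dom c \<Longrightarrow> x \<in> carrier_set \<A>"
  unfolding carrier_set_def by blast

lemma chart_is_chart: "c \<in> \<A> \<Longrightarrow> is_chart M c"
  using manifold by (simp add: smooth_manifold_def)

lemma chart_inj: "c \<in> \<A> \<Longrightarrow> inj_on (chart_map c) (chart_dom c)"
  using chart_is_chart[of c] homeomorphic_imp_injective_map openin_subset
  by (fastforce simp: is_chart_def Int_absorb1)

lemma chart_inv_map: "c \<in> \<A> \<Longrightarrow> x \<in> chart_dom c \<Longrightarrow> chart_inv c (chart_map c x) = x"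
  by (simp add: chart_inj)

lemma open_chart_image: "c \<in> \<A> \<Longrightarrow> open (chart_map c ` chart_dom c)"
  using chart_is_chart by (simp add: is_chart_def)

text \<open>A homeomorphism is open onto its image with the subspace topology; the image is itself
  open in the Euclidean space, so relatively open sets are open.\<close>

lemma open_chart_overlap:
  assumes "c \<in> \<A>" "d \<in> \<A>"
  shows "open (chart_map c ` (chart_dom c \<inter> chart_dom d))"
proof -
  have "openin (subtopology M (chart_dom c)) (chart_dom c \<inter> chart_dom d)"
    using chart_is_chart[OF assms(2)] by (simp add: is_chart_def openin_subtopology_Int2)
  then have "openin (top_of_set (chart_map c ` chart_dom c))
      (chart_map c ` (chart_dom c \<inter> chart_dom d))"
    using chart_is_chart[OF assms(1)] homeomorphic_imp_open_map
    unfolding is_chart_def open_map_def by blast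
  then show ?thesis
    using openin_open_trans open_chart_image[OF assms(1)] by blast
qed

lemma transition_has_derivative:
  assumes "c \<in> charts_at \<A> x" "d \<in> charts_at \<A> x"
  shows "((chart_map d \<circ> chart_inv c) has_derivative
    frechet_derivative (chart_map d \<circ> chart_inv c) (at (chart_map c x))) (at (chart_map c x))"
proof (rule smooth_on_has_derivative)
  show "smooth_on (chart_map c ` (chart_dom c \<inter> chart_dom d)) (chart_map d \<circ> chart_inv c)"
    using manifold assms by (simp add: smooth_manifold_def charts_at_def)
qed (use assms in \<open>auto simp: charts_at_def\<close>)

text \<open>This is the chain rule. The factorization through the transition map holds only on the
  image of the overlap, which is an open neighbourhood of the point.\<close>

lemma has_derivative_chart_change:
  assumes c: "c \<in> charts_at \<A> x" and d: "d \<in> charts_at \<A> x"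
    and f: "((f \<circ> chart_inv d) has_derivative f') (at (chart_map d x))"
  shows "((f \<circ> chart_inv c) has_derivative
    f' \<circ> frechet_derivative (chart_map d \<circ> chart_inv c) (at (chart_map c x))) (at (chart_map c x))"
proof (rule has_derivative_transform_within_open)
  have *: "(chart_map d \<circ> chart_inv c) (chart_map c x) = chart_map d x"
    using c by (simp add: charts_at_def chart_inv_map)
  show "((f \<circ> chart_inv d) \<circ> (chart_map d \<circ> chart_inv c) has_derivative
    f' \<circ> frechet_derivative (chart_map d \<circ> chart_inv c) (at (chart_map c x))) (at (chart_map c x))"
    by (rule diff_chain_at[OF transition_has_derivative[OF c d]]) (use f * in simp)
  show "open (chart_map c ` (chart_dom c \<inter> chart_dom d))"
    using c d by (auto simp: charts_at_def intro: open_chart_overlap)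
  show "chart_map c x \<in> chart_map c ` (chart_dom c \<inter> chart_dom d)"
    using c d by (auto simp: charts_at_def)
  fix p assume "p \<in> chart_map c ` (chart_dom c \<inter> chart_dom d)"
  then show "((f \<circ> chart_inv d) \<circ> (chart_map d \<circ> chart_inv c)) p = (f \<circ> chart_inv c) p"
    using c d by (auto simp: charts_at_def chart_inv_map)
qed

section \<open>Tangent spaces\<close>

lemma tangent_space_ext:
  assumes "u \<in> tangent_space \<A> x" "v \<in> tangent_space \<A> x" "c \<in> charts_at \<A> x" "u c = v c"
  shows "u = v"
proof
  fix d
  show "u d = v d"
  proof (cases "d \<in> charts_at \<A> x")
    case True
    then have "w d = frechet_derivative (chart_map d \<circ> chart_inv c) (at (chart_map c x)) (w c)"
      if "w \<in> tangent_space \<A> x" for w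
      using that assms(3) unfolding tangent_space_def by blast
    then show ?thesis using assms by metis
  next
    case False
    then have "w d = 0" if "w \<in> tangent_space \<A> x" for w
      using that unfolding tangent_space_def by blast
    from this[OF assms(1)] this[OF assms(2)] show ?thesis by simp
  qed
qed

text \<open>The coordinates \<open>w\<close> are transported to every chart around \<open>x\<close>
  by the derivatives of the transition maps. This is used to see that the local matrix of
  \<open>X\<close> is surjective.\<close>

lemma tangent_space_coordinates:
  assumes c: "c \<in> charts_at \<A> x"
  obtains v where "v \<in> tangent_space \<A> x" "v c = w"
proof -
  let ?T = "\<lambda>d e. frechet_derivative (chart_map e \<circ> chart_inv d) (at (chart_map d x))"
  define v where "v = (\<lambda>d. if d \<in> charts_at \<A> x then ?T c d w else 0)"
  have "v \<in> tangent_space \<A> x"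
    unfolding tangent_space_def mem_Collect_eq
  proof (intro conjI ballI allI impI)
    fix d assume "d \<notin> charts_at \<A> x"
    then show "v d = 0" by (simp add: v_def)
  next
    fix d e assume d: "d \<in> charts_at \<A> x" and e: "e \<in> charts_at \<A> x"
    \<comment> \<open>The cocycle identity for transition derivatives makes the transported
      coordinates consistent.\<close>
    have "?T c e = ?T d e \<circ> ?T c d"
      using frechet_derivative_at[OF has_derivative_chart_change[OF c d
            transition_has_derivative[OF d e]]] ..
    then show "v e = ?T d e (v d)"
      using d e by (simp add: v_def)
  qed
  moreover have "v c = w"
  proof -
    \<comment> \<open>The transition from \<open>c\<close> to itself is the identity near the point,
      hence its derivative returns \<open>w\<close>.\<close>
    have "((chart_map c \<circ> chart_inv c) has_derivative (\<lambda>h. h)) (at (chart_map c x))"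
    proof (rule has_derivative_transform_within_open[OF has_derivative_ident])
      show "open (chart_map c ` chart_dom c)" "chart_map c x \<in> chart_map c ` chart_dom c"
        using c by (auto simp: charts_at_def intro: open_chart_image)
    qed (auto simp: f_inv_into_f)
    from frechet_derivative_at[OF this, symmetric] show ?thesis
      using c by (simp add: v_def)
  qed
  ultimately show ?thesis by (rule that)
qed

lemma subspace_tangent_space: "subspace (tangent_space \<A> x)"
proof -
  have lin: "linear (frechet_derivative (chart_map d \<circ> chart_inv c) (at (chart_map c x)))"
    if "c \<in> charts_at \<A> x" "d \<in> charts_at \<A> x" for c d
    using transition_has_derivative[OF that] by (rule has_derivative_linear)
  have change: "v d = frechet_derivative (chart_map d \<circ> chart_inv c) (at (chart_map c x)) (v c)"
    if "v \<in> tangent_space \<A> x" "c \<in> charts_at \<A> x" "d \<in> charts_at \<A> x" for v c d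
    using that unfolding tangent_space_def by blast
  have null: "v c = 0" if "v \<in> tangent_space \<A> x" "c \<notin> charts_at \<A> x" for v c
    using that unfolding tangent_space_def by blast
  show ?thesis
  proof (rule subspaceI)
    show "0 \<in> tangent_space \<A> x"
      unfolding tangent_space_def using linear_0[OF lin] by simp
    fix u v assume u: "u \<in> tangent_space \<A> x"
    show "a *\<^sub>R u \<in> tangent_space \<A> x" for a
      unfolding tangent_space_def mem_Collect_eq
    proof (intro conjI ballI allI impI)
      fix c d assume cd: "c \<in> charts_at \<A> x" "d \<in> charts_at \<A> x"
      show "(a *\<^sub>R u) d =
          frechet_derivative (chart_map d \<circ> chart_inv c) (at (chart_map c x)) ((a *\<^sub>R u) c)"
        by (simp only: scaleR_fun_apply linear_scale[OF lin[OF cd]] change[OF u cd])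
    qed (simp add: null[OF u])
    assume v: "v \<in> tangent_space \<A> x"
    show "u + v \<in> tangent_space \<A> x"
      unfolding tangent_space_def mem_Collect_eq
    proof (intro conjI ballI allI impI)
      fix c d assume cd: "c \<in> charts_at \<A> x" "d \<in> charts_at \<A> x"
      show "(u + v) d =
          frechet_derivative (chart_map d \<circ> chart_inv c) (at (chart_map c x)) ((u + v) c)"
        by (simp only: plus_fun_apply linear_add[OF lin[OF cd]] change[OF u cd] change[OF v cd])
    qed (simp add: null[OF u] null[OF v])
  qed
qed

section \<open>Smooth maps and their differentials\<close>

lemma some_chart:
  assumes "x \<in> carrier_set \<A>"
  shows "(SOME c. c \<in> charts_at \<A> x) \<in> charts_at \<A> x"
proof (rule someI_ex)
  show "\<exists>c. c \<in> charts_at \<A> x"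
    using assms by (auto simp: carrier_set_def charts_at_def)
qed

lemma smooth_map_has_derivative:
  assumes "smooth_map \<A> f" "c \<in> charts_at \<A> x"
  shows "((f \<circ> chart_inv c) has_derivative
    frechet_derivative (f \<circ> chart_inv c) (at (chart_map c x))) (at (chart_map c x))"
  using assms unfolding smooth_map_def charts_at_def
  by (intro smooth_on_has_derivative[where S = "chart_map c ` chart_dom c"]) auto

text \<open>The chain rule for the chart change and the compatibility condition on \<open>v\<close>
  cancel, so the chart picked by \<open>SOME\<close> can be exchanged for any
  \<open>c\<close>.\<close>

lemma differential_in_chart:
  assumes "smooth_map \<A> f" "v \<in> tangent_space \<A> x" "c \<in> charts_at \<A> x"
  shows "differential \<A> f x v = frechet_derivative (f \<circ> chart_inv c) (at (chart_map c x)) (v c)"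
proof -
  define d where "d = (SOME c. c \<in> charts_at \<A> x)"
  have d: "d \<in> charts_at \<A> x"
    unfolding d_def using assms(3) by (rule someI)
  have "v d = frechet_derivative (chart_map d \<circ> chart_inv c) (at (chart_map c x)) (v c)"
    using assms(2,3) d unfolding tangent_space_def by blast
  moreover have "frechet_derivative (f \<circ> chart_inv c) (at (chart_map c x)) =
      frechet_derivative (f \<circ> chart_inv d) (at (chart_map d x)) \<circ>
      frechet_derivative (chart_map d \<circ> chart_inv c) (at (chart_map c x))"
    using frechet_derivative_at[OF has_derivative_chart_change[OF assms(3) d
          smooth_map_has_derivative[OF assms(1) d]]] ..
  ultimately show ?thesis
    by (simp add: differential_def d_def[symmetric])
qed

text \<open>Asking for the derivative in every chart around \<open>x\<close> covers the one picked
  by \<open>SOME\<close>; the rules of calculus below are lifted from charts in this way.\<close>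

lemma differential_eqI:
  assumes "x \<in> carrier_set \<A>"
    and "\<And>c. c \<in> charts_at \<A> x \<Longrightarrow>
      ((f \<circ> chart_inv c) has_derivative f' c) (at (chart_map c x)) \<and> f' c (v c) = w"
  shows "differential \<A> f x v = w"
proof -
  define c where "c = (SOME c. c \<in> charts_at \<A> x)"
  have "c \<in> charts_at \<A> x"
    unfolding c_def by (rule some_chart[OF assms(1)])
  from assms(2)[OF this] have "f' c = frechet_derivative (f \<circ> chart_inv c) (at (chart_map c x))"
    "f' c (v c) = w"
    by (auto intro: frechet_derivative_at)
  then show ?thesis
    unfolding differential_def Let_def c_def by simp
qed

lemma smooth_map_cong:
  assumes "smooth_map \<A> f" "\<And>x. x \<in> carrier_set \<A> \<Longrightarrow> f x = g x"
  shows "smooth_map \<A> g"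
  unfolding smooth_map_def
proof
  fix c assume c: "c \<in> \<A>"
  show "smooth_on (chart_map c ` chart_dom c) (g \<circ> chart_inv c)"
    by (rule smooth_on_cong[OF open_chart_image[OF c], of "f \<circ> chart_inv c"])
      (use assms c in \<open>auto simp: smooth_map_def chart_inv_map chart_dom_carrier\<close>)
qed

lemma differential_cong:
  assumes "smooth_map \<A> f" "x \<in> carrier_set \<A>" "\<And>y. y \<in> carrier_set \<A> \<Longrightarrow> f y = g y"
  shows "differential \<A> f x v = differential \<A> g x v"
proof -
  define c where "c = (SOME c. c \<in> charts_at \<A> x)"
  have c: "c \<in> charts_at \<A> x"
    unfolding c_def by (rule some_chart[OF assms(2)])
  have "frechet_derivative (f \<circ> chart_inv c) (at (chart_map c x)) =
      frechet_derivative (g \<circ> chart_inv c) (at (chart_map c x))"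
  proof (rule frechet_derivative_transform_within_open)
    show "(f \<circ> chart_inv c) differentiable at (chart_map c x)"
      using smooth_map_has_derivative[OF assms(1) c] by (auto simp: differentiable_def)
    show "open (chart_map c ` chart_dom c)" "chart_map c x \<in> chart_map c ` chart_dom c"
      using c by (auto simp: charts_at_def intro: open_chart_image)
    fix p assume "p \<in> chart_map c ` chart_dom c"
    then show "(f \<circ> chart_inv c) p = (g \<circ> chart_inv c) p"
      using c by (auto simp: charts_at_def chart_inv_map carrier_set_def intro!: assms(3))
  qed
  then show ?thesis
    by (simp add: differential_def c_def[symmetric])
qed

lemma smooth_map_const: "smooth_map \<A> (\<lambda>x. a)"
  by (simp add: smooth_map_def o_def smooth_on_const)

lemma smooth_map_bounded_linear:
  "bounded_linear L \<Longrightarrow> smooth_map \<A> f \<Longrightarrow> smooth_map \<A> (\<lambda>x. L (f x))"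
  unfolding smooth_map_def o_def using smooth_on_bounded_linear[OF open_chart_image] by blast

lemma smooth_map_bilinear:
  "bounded_bilinear h \<Longrightarrow> smooth_map \<A> f \<Longrightarrow> smooth_map \<A> g \<Longrightarrow>
    smooth_map \<A> (\<lambda>x. h (f x) (g x))"
  unfolding smooth_map_def o_def using smooth_on_bilinear[OF open_chart_image] by blast

lemma smooth_map_component:
  fixes w :: "'a \<Rightarrow> real ^ 'k"
  shows "smooth_map \<A> w \<Longrightarrow> smooth_map \<A> (\<lambda>x. w x $ i)"
  by (rule smooth_map_bounded_linear[OF bounded_linear_vec_nth])

lemma differential_const: "x \<in> carrier_set \<A> \<Longrightarrow> differential \<A> (\<lambda>y. a) x v = 0"
  by (rule differential_eqI[where f' = "\<lambda>c h. 0"]) (simp_all add: o_def)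

lemma differential_bounded_linear:
  assumes "bounded_linear L" "smooth_map \<A> f" "x \<in> carrier_set \<A>" "v \<in> tangent_space \<A> x"
  shows "differential \<A> (\<lambda>y. L (f y)) x v = L (differential \<A> f x v)"
proof (rule differential_eqI[OF assms(3)], rule conjI)
  fix c assume c: "c \<in> charts_at \<A> x"
  show "((\<lambda>y. L (f y)) \<circ> chart_inv c has_derivative
      (\<lambda>h. L (frechet_derivative (f \<circ> chart_inv c) (at (chart_map c x)) h))) (at (chart_map c x))"
    using bounded_linear.has_derivative[OF assms(1) smooth_map_has_derivative[OF assms(2) c]]
    by (simp add: o_def)
qed (simp add: differential_in_chart[OF assms(2,4)])

lemma differential_add:
  assumes "smooth_map \<A> f" "smooth_map \<A> g" "x \<in> carrier_set \<A>" "v \<in> tangent_space \<A> x"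
  shows "differential \<A> (\<lambda>y. f y + g y) x v = differential \<A> f x v + differential \<A> g x v"
proof (rule differential_eqI[OF assms(3)], rule conjI)
  fix c assume c: "c \<in> charts_at \<A> x"
  show "((\<lambda>y. f y + g y) \<circ> chart_inv c has_derivative
      (\<lambda>h. frechet_derivative (f \<circ> chart_inv c) (at (chart_map c x)) h +
        frechet_derivative (g \<circ> chart_inv c) (at (chart_map c x)) h)) (at (chart_map c x))"
    using has_derivative_add[OF smooth_map_has_derivative[OF assms(1) c]
        smooth_map_has_derivative[OF assms(2) c]]
    by (simp add: o_def)
qed (simp add: differential_in_chart[OF assms(1,4)] differential_in_chart[OF assms(2,4)])

lemma differential_bilinear:
  assumes "bounded_bilinear h" "smooth_map \<A> f" "smooth_map \<A> g"
    and "x \<in> carrier_set \<A>" "v \<in> tangent_space \<A> x"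
  shows "differential \<A> (\<lambda>y. h (f y) (g y)) x v =
    h (f x) (differential \<A> g x v) + h (differential \<A> f x v) (g x)"
proof (rule differential_eqI[OF assms(4)], rule conjI)
  fix c assume c: "c \<in> charts_at \<A> x"
  then have x: "chart_inv c (chart_map c x) = x"
    by (simp add: charts_at_def chart_inv_map)
  show "((\<lambda>y. h (f y) (g y)) \<circ> chart_inv c has_derivative
      (\<lambda>w. h (f x) (frechet_derivative (g \<circ> chart_inv c) (at (chart_map c x)) w) +
        h (frechet_derivative (f \<circ> chart_inv c) (at (chart_map c x)) w) (g x))) (at (chart_map c x))"
    using bounded_bilinear.FDERIV[OF assms(1) smooth_map_has_derivative[OF assms(2) c]
        smooth_map_has_derivative[OF assms(3) c]]
    by (simp add: o_def x)
qed (simp add: differential_in_chart[OF assms(2,5)] differential_in_chart[OF assms(3,5)])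

lemma differential_linear:
  assumes "smooth_map \<A> f" "x \<in> carrier_set \<A>"
  shows "differential \<A> f x (a *\<^sub>R u + b *\<^sub>R v) =
    a *\<^sub>R differential \<A> f x u + b *\<^sub>R differential \<A> f x v"
proof -
  note lin = has_derivative_linear[OF smooth_map_has_derivative[OF assms(1) some_chart[OF assms(2)]]]
  show ?thesis
    by (simp add: differential_def Let_def linear_add[OF lin] linear_scale[OF lin])
qed

lemma smooth_vector_field_tangent:
  "smooth_vector_field \<A> Z \<Longrightarrow> x \<in> carrier_set \<A> \<Longrightarrow> Z x \<in> tangent_space \<A> x"
  by (simp add: smooth_vector_field_def)

text \<open>Smoothness of a derivative is known in a fixed direction, whereas \<open>V\<close>
  varies with the point. Expanding \<open>V\<close> in the standard basis reduces to fixed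
  directions with smooth coefficients.\<close>

lemma smooth_map_differential:
  assumes "smooth_map \<A> f" "smooth_vector_field \<A> V"
  shows "smooth_map \<A> (\<lambda>x. differential \<A> f x (V x))"
  unfolding smooth_map_def
proof
  fix c assume c: "c \<in> \<A>"
  let ?S = "chart_map c ` chart_dom c" and ?V = "\<lambda>p. V (chart_inv c p) c"
    and ?D = "\<lambda>p. frechet_derivative (f \<circ> chart_inv c) (at p)"
  note S = open_chart_image[OF c]
  have V: "smooth_on ?S ?V" and f: "smooth_on ?S (f \<circ> chart_inv c)"
    using assms c by (auto simp: smooth_vector_field_def smooth_map_def)
  have "smooth_on ?S (\<lambda>p. \<Sum>i\<in>UNIV. ?V p $ i *\<^sub>R ?D p (axis i 1))"
    by (intro smooth_on_sum[OF S] smooth_on_bilinear[OF S bounded_bilinear_scaleR]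
        smooth_on_frechet_derivative f smooth_on_bounded_linear[OF S bounded_linear_vec_nth V])
  then show "smooth_on ?S ((\<lambda>x. differential \<A> f x (V x)) \<circ> chart_inv c)"
  proof (rule smooth_on_cong[OF S])
    fix p assume p: "p \<in> ?S"
    then obtain x where x: "x \<in> chart_dom c" "p = chart_map c x" by blast
    have cx: "c \<in> charts_at \<A> x" using x c by (simp add: charts_at_def)
    have inv: "chart_inv c p = x" using x c by (simp add: chart_inv_map)
    have lin: "linear (?D p)"
      using smooth_on_has_derivative[OF f p] by (rule has_derivative_linear)
    have "?D p (?V p) = ?D p (\<Sum>i\<in>UNIV. ?V p $ i *\<^sub>R axis i 1)"
      by (simp only: basis_scaleR_expansion)
    then have "?D p (?V p) = (\<Sum>i\<in>UNIV. ?V p $ i *\<^sub>R ?D p (axis i 1))"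
      by (simp only: linear_sum[OF lin] linear_scale[OF lin])
    moreover have "V x \<in> tangent_space \<A> x"
      using assms(2) x c by (auto simp: smooth_vector_field_def carrier_set_def)
    ultimately show "(\<Sum>i\<in>UNIV. ?V p $ i *\<^sub>R ?D p (axis i 1)) =
        ((\<lambda>x. differential \<A> f x (V x)) \<circ> chart_inv c) p"
      using differential_in_chart[OF assms(1) _ cx] inv x by simp
  qed
qed

section \<open>Smooth vector fields and affine connections acting on them\<close>

lemma smooth_vector_field_cong:
  assumes "smooth_vector_field \<A> Z" "\<And>x. x \<in> carrier_set \<A> \<Longrightarrow> Z x = W x"
  shows "smooth_vector_field \<A> W"
  unfolding smooth_vector_field_def
proof (intro conjI ballI)
  fix c assume c: "c \<in> \<A>"
  show "smooth_on (chart_map c ` chart_dom c) (\<lambda>p. W (chart_inv c p) c)"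
    by (rule smooth_on_cong[OF open_chart_image[OF c], of "\<lambda>p. Z (chart_inv c p) c"])
      (use assms c in \<open>auto simp: smooth_vector_field_def chart_inv_map chart_dom_carrier\<close>)
qed (use assms in \<open>auto simp: smooth_vector_field_def\<close>)

lemma smooth_vector_field_zero: "smooth_vector_field \<A> (\<lambda>x. 0)"
  using subspace_tangent_space
  by (simp add: smooth_vector_field_def smooth_on_const subspace_0)

lemma smooth_vector_field_add:
  assumes "smooth_vector_field \<A> Z" "smooth_vector_field \<A> W"
  shows "smooth_vector_field \<A> (\<lambda>x. Z x + W x)"
  unfolding smooth_vector_field_def
proof (intro conjI ballI)
  fix c assume c: "c \<in> \<A>"
  have "smooth_on (chart_map c ` chart_dom c) (\<lambda>p. Z (chart_inv c p) c + W (chart_inv c p) c)"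
    using assms c by (intro smooth_on_add open_chart_image) (auto simp: smooth_vector_field_def)
  then show "smooth_on (chart_map c ` chart_dom c) (\<lambda>p. (Z (chart_inv c p) + W (chart_inv c p)) c)"
    by simp
qed (intro subspace_add[OF subspace_tangent_space] smooth_vector_field_tangent assms)

lemma smooth_vector_field_scale:
  assumes "smooth_map \<A> f" "smooth_vector_field \<A> Z"
  shows "smooth_vector_field \<A> (\<lambda>x. f x *\<^sub>R Z x)"
  unfolding smooth_vector_field_def
proof (intro conjI ballI)
  fix c assume c: "c \<in> \<A>"
  have "smooth_on (chart_map c ` chart_dom c) (\<lambda>p. f (chart_inv c p) *\<^sub>R Z (chart_inv c p) c)"
    using assms c
    by (intro smooth_on_bilinear[OF _ bounded_bilinear_scaleR] open_chart_image)
      (auto simp: smooth_vector_field_def smooth_map_def o_def)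
  then show "smooth_on (chart_map c ` chart_dom c)
      (\<lambda>p. (f (chart_inv c p) *\<^sub>R Z (chart_inv c p)) c)"
    by simp
qed (intro subspace_scale[OF subspace_tangent_space] smooth_vector_field_tangent assms)

lemma smooth_vector_field_sum:
  assumes "\<And>i. i \<in> I \<Longrightarrow> smooth_vector_field \<A> (Z i)"
  shows "smooth_vector_field \<A> (\<lambda>x. \<Sum>i\<in>I. Z i x)"
  using assms
proof (induction I rule: infinite_finite_induct)
  case (insert i I)
  then have "smooth_vector_field \<A> (\<lambda>x. Z i x + (\<Sum>i\<in>I. Z i x))"
    by (intro smooth_vector_field_add) auto
  then show ?case by (simp only: sum.insert[OF insert.hyps])
next
  case (infinite I)
  show ?case by (simp only: sum.infinite[OF infinite.hyps(1)] smooth_vector_field_zero)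
qed (simp only: sum.empty smooth_vector_field_zero)

text \<open>Values of a field off the manifold are removed by the Leibniz rule for the indicator
  function of the complement of the manifold.\<close>

lemma affine_connection_cong:
  assumes D: "affine_connection \<A> D" and Z: "smooth_vector_field \<A> Z"
    and W: "smooth_vector_field \<A> W"
    and x: "x \<in> carrier_set \<A>" and v: "v \<in> tangent_space \<A> x"
    and eq: "\<And>y. y \<in> carrier_set \<A> \<Longrightarrow> Z y = W y"
  shows "D Z x v = D W x v"
proof -
  define f :: "'a \<Rightarrow> real" where "f = indicator (- carrier_set \<A>)"
  define R where "R = (\<lambda>y. Z y - W y)"
  have f: "smooth_map \<A> f"
    by (rule smooth_map_cong[OF smooth_map_const[of 0]]) (simp add: f_def)
  have R0: "R y = 0" if "y \<in> carrier_set \<A>" for y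
    using eq[OF that] by (simp only: R_def diff_self)
  have R: "smooth_vector_field \<A> R"
    by (rule smooth_vector_field_cong[OF smooth_vector_field_zero]) (simp only: R0)
  \<comment> \<open>On the manifold both sides vanish, off it \<open>f\<close> is 1. The Leibniz
    rule at \<open>x\<close>, where \<open>f\<close> and \<open>R\<close> are both 0, then gives
    0.\<close>
  have "f y *\<^sub>R R y = R y" for y
    by (cases "y \<in> carrier_set \<A>") (simp_all only: R0 scaleR_zero_right f_def indicator_simps
        Compl_iff not_True_eq_False not_False_eq_True scaleR_one)
  then have "D R x v = D (\<lambda>y. f y *\<^sub>R R y) x v" by (simp only:)
  also have "\<dots> = differential \<A> f x v *\<^sub>R R x + f x *\<^sub>R D R x v"
    using D f R x v unfolding affine_connection_def by blast
  also have "\<dots> = 0"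
    using x by (simp only: R0[OF x] scaleR_zero_right f_def indicator_simps
        Compl_iff not_True_eq_False not_False_eq_True scaleR_zero_left add_0)
  finally have "D R x v = 0" .
  moreover have "D (\<lambda>y. W y + R y) x v = D W x v + D R x v"
    using D W R x v unfolding affine_connection_def by blast
  moreover have "(\<lambda>y. W y + R y) = Z" by (simp add: R_def fun_eq_iff)
  ultimately show ?thesis by (simp only: add_0_right)
qed

text \<open>Separates the terms that differentiate coefficients from those that differentiate
  fields; uniqueness compares variable with constant coefficients by means of it.\<close>

lemma affine_connection_sum_scale:
  fixes f :: "'i \<Rightarrow> 'a \<Rightarrow> real"
  assumes D: "affine_connection \<A> D" and "finite I"
    and f: "\<And>i. smooth_map \<A> (f i)" and Z: "\<And>i. smooth_vector_field \<A> (Z i)"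
    and x: "x \<in> carrier_set \<A>" and v: "v \<in> tangent_space \<A> x"
  shows "D (\<lambda>y. \<Sum>i\<in>I. f i y *\<^sub>R Z i y) x v =
    (\<Sum>i\<in>I. differential \<A> (f i) x v *\<^sub>R Z i x) + (\<Sum>i\<in>I. f i x *\<^sub>R D (Z i) x v)"
proof -
  have leibniz: "D (\<lambda>y. f y *\<^sub>R Z y) x v = differential \<A> f x v *\<^sub>R Z x + f x *\<^sub>R D Z x v"
    if "smooth_map \<A> f" "smooth_vector_field \<A> Z" for f :: "'a \<Rightarrow> real" and Z
    using D that x v unfolding affine_connection_def by blast
  have add: "D (\<lambda>y. Z y + W y) x v = D Z x v + D W x v"
    if "smooth_vector_field \<A> Z" "smooth_vector_field \<A> W" for Z W
    using D that x v unfolding affine_connection_def by blast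
  \<comment> \<open>The empty sum: the Leibniz rule is applied to the zero field multiplied by the
    function 0.\<close>
  have zero: "D (\<lambda>y. 0) x v = 0"
    using leibniz[OF smooth_map_const[of 0] smooth_vector_field_zero] differential_const[OF x, of "0::real"]
    by (simp only: scaleR_zero_left scaleR_zero_right add_0)
  have "D (\<lambda>y. \<Sum>i\<in>I. f i y *\<^sub>R Z i y) x v =
      (\<Sum>i\<in>I. differential \<A> (f i) x v *\<^sub>R Z i x + f i x *\<^sub>R D (Z i) x v)"
    using \<open>finite I\<close>
  proof (induction I)
    case (insert i I)
    show ?case
      by (simp only: sum.insert[OF insert.hyps] insert.IH
          add[OF smooth_vector_field_scale[OF f Z]
            smooth_vector_field_sum[OF smooth_vector_field_scale[OF f Z]]]
          leibniz[OF f Z])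
  qed (simp only: sum.empty zero)
  then show ?thesis by (simp only: sum.distrib)
qed

end

section \<open>The adjoint of a non-degenerate coefficient\<close>

lemma chart_eval_linear: "linear (\<lambda>v :: ('a, 'n::finite) tvec. v c)"
  by (rule linearI) simp_all

text \<open>The quadratic form of the Gram matrix at \<open>w\<close> is the squared norm of
  \<open>transpose A *v w\<close>. A null vector is thus orthogonal to the range of
  \<open>A\<close>, which is everything.\<close>

lemma det_surj_gram_nonzero:
  fixes A :: "real ^ 'm ^ 'k"
  assumes "surj ((*v) A)"
  shows "det (A ** transpose A) \<noteq> 0"
proof -
  have "w = 0" if "(A ** transpose A) *v w = 0" for w
  proof -
    have "(transpose A *v w) \<bullet> (transpose A *v w) = w \<bullet> ((A ** transpose A) *v w)"
      by (simp add: dot_lmul_matrix[symmetric] matrix_vector_mul_assoc[symmetric] transpose_matrix_vector)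
    then have z: "transpose A *v w = 0" using that by simp
    obtain e where "w = A *v e" using assms by blast
    then have "w \<bullet> w = (transpose A *v w) \<bullet> e"
      by (simp add: dot_lmul_matrix transpose_matrix_vector)
    then show ?thesis using z by simp
  qed
  then have "inj ((*v) (A ** transpose A))"
    by (simp add: linear_injective_0 matrix_vector_mul_linear)
  then show ?thesis
    by (simp add: det_nz_iff_inj[OF matrix_vector_mul_linear, symmetric] matrix_of_matrix_vector_mul)
qed

locale smooth_frame = smooth_atlas M \<A>
  for M :: "'a topology" and \<A> :: "('a, 'n::finite) chart set" +
  fixes X :: "'a \<Rightarrow> real ^ 'm::finite \<Rightarrow> ('a, 'n) tvec"
  assumes smooth_coefficient: "smooth_coefficient \<A> X"
    and range_X: "x \<in> carrier_set \<A> \<Longrightarrow> range (X x) = tangent_space \<A> x"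
begin

text \<open>Written as an inverse so that \<open>induced_metric\<close> unfolds to an inner product
  of values of \<open>Y\<close>; \<open>adjoint_coefficient_eq_Y\<close> identifies it with the
  adjoint.\<close>

abbreviation Y :: "'a \<Rightarrow> ('a, 'n) tvec \<Rightarrow> real ^ 'm" where
  "Y x \<equiv> inv_into (ker_perp X x) (X x)"

lemma linear_X: "x \<in> carrier_set \<A> \<Longrightarrow> linear (X x)"
  using smooth_coefficient by (simp add: smooth_coefficient_def)

lemma smooth_vector_field_X: "smooth_vector_field \<A> (\<lambda>x. X x e)"
  using smooth_coefficient by (simp add: smooth_coefficient_def)

lemma X_tangent: "x \<in> carrier_set \<A> \<Longrightarrow> X x e \<in> tangent_space \<A> x"
  using range_X by blast

section \<open>The inverse of the coefficient on the orthogonal complement of its kernel\<close>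

lemma subspace_kernel_X:
  assumes "x \<in> carrier_set \<A>" shows "subspace {e. X x e = 0}"
  using linear_subspace_kernel[OF linear_X[OF assms]] .

lemma subspace_ker_perp: "subspace (ker_perp X x)"
  unfolding ker_perp_def by (rule subspace_orthogonal_comp)

lemma ker_perp_inner_kernel: "p \<in> ker_perp X x \<Longrightarrow> X x e = 0 \<Longrightarrow> p \<bullet> e = 0"
  by (auto simp: ker_perp_def orthogonal_comp_def orthogonal_def inner_commute)

text \<open>The difference of two points with equal image lies in the kernel and in its complement,
  so it is orthogonal to itself.\<close>

lemma inj_on_ker_perp:
  assumes "x \<in> carrier_set \<A>" shows "inj_on (X x) (ker_perp X x)"
proof (rule inj_onI)
  fix p q assume pq: "p \<in> ker_perp X x" "q \<in> ker_perp X x" "X x p = X x q"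
  then have "X x (p - q) = 0"
    by (simp add: linear_diff[OF linear_X[OF assms]])
  moreover have "p - q \<in> ker_perp X x"
    using pq by (intro subspace_diff[OF subspace_ker_perp])
  ultimately have "(p - q) \<bullet> (p - q) = 0"
    by (intro ker_perp_inner_kernel)
  then show "p = q" by simp
qed

text \<open>Removing the kernel component of any preimage leaves a preimage in the orthogonal
  complement.\<close>

lemma Y_in_ker_perp_and_X_Y:
  assumes x: "x \<in> carrier_set \<A>" and u: "u \<in> tangent_space \<A> x"
  shows "Y x u \<in> ker_perp X x" "X x (Y x u) = u"
proof -
  obtain e where e: "u = X x e" using range_X[OF x] u by blast
  obtain k p where kp: "e = k + p" "k \<in> {e. X x e = 0}" "p \<in> ker_perp X x"
    using subspace_sum_orthogonal_comp[OF subspace_kernel_X[OF x]] set_plus_elim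
    unfolding ker_perp_def by (metis UNIV_I)
  then have "u = X x p"
    by (simp add: e linear_add[OF linear_X[OF x]])
  then have "u \<in> X x ` ker_perp X x" using kp by blast
  then show "Y x u \<in> ker_perp X x" "X x (Y x u) = u"
    by (rule inv_into_into, rule f_inv_into_f)
qed

lemma Y_eqI:
  assumes "x \<in> carrier_set \<A>" "p \<in> ker_perp X x" "X x p = u"
  shows "Y x u = p"
  using inv_into_f_f[OF inj_on_ker_perp[OF assms(1)] assms(2)] assms(3) by simp

lemma Y_linear:
  assumes x: "x \<in> carrier_set \<A>" and uv: "u \<in> tangent_space \<A> x" "v \<in> tangent_space \<A> x"
  shows "Y x (a *\<^sub>R u + b *\<^sub>R v) = a *\<^sub>R Y x u + b *\<^sub>R Y x v"
proof (rule Y_eqI[OF x])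
  show "a *\<^sub>R Y x u + b *\<^sub>R Y x v \<in> ker_perp X x"
    using Y_in_ker_perp_and_X_Y[OF x] uv
    by (intro subspace_add subspace_scale subspace_ker_perp) auto
  show "X x (a *\<^sub>R Y x u + b *\<^sub>R Y x v) = a *\<^sub>R u + b *\<^sub>R v"
    using Y_in_ker_perp_and_X_Y[OF x] uv
    by (simp only: linear_add[OF linear_X[OF x]] linear_scale[OF linear_X[OF x]])
qed

text \<open>The vectors \<open>e\<close> and \<open>Y x (X x e)\<close> differ by an element of the
  kernel. Hence \<open>Y x\<close> after \<open>X x\<close> is the orthogonal projection onto
  \<open>ker_perp X x\<close>.\<close>

lemma ker_perp_inner_Y_X:
  assumes x: "x \<in> carrier_set \<A>" and p: "p \<in> ker_perp X x"
  shows "p \<bullet> Y x (X x e) = p \<bullet> e"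
proof -
  have "X x (e - Y x (X x e)) = 0"
    using Y_in_ker_perp_and_X_Y(2)[OF x X_tangent[OF x]]
    by (simp only: linear_diff[OF linear_X[OF x]] diff_self)
  then have "p \<bullet> (e - Y x (X x e)) = 0" by (rule ker_perp_inner_kernel[OF p])
  then show ?thesis by (simp add: inner_diff_right)
qed

text \<open>By \<open>ker_perp_inner_Y_X\<close> the condition defining the adjoint says that
  \<open>y\<close> and \<open>Y x u\<close> have the same inner product with every
  \<open>e\<close>.\<close>

lemma adjoint_coefficient_eq_Y:
  assumes x: "x \<in> carrier_set \<A>" and u: "u \<in> tangent_space \<A> x"
  shows "adjoint_coefficient X x u = Y x u"
  unfolding adjoint_coefficient_def induced_metric_def
proof (rule the_equality)
  show "\<forall>e. Y x u \<bullet> e = Y x u \<bullet> Y x (X x e)"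
    using ker_perp_inner_Y_X[OF x] Y_in_ker_perp_and_X_Y(1)[OF x u] by simp
  fix y assume "\<forall>e. y \<bullet> e = Y x u \<bullet> Y x (X x e)"
  then have "\<forall>e. y \<bullet> e = Y x u \<bullet> e"
    using ker_perp_inner_Y_X[OF x] Y_in_ker_perp_and_X_Y(1)[OF x u] by simp
  then show "y = Y x u" using vector_eq_rdot by blast
qed

text \<open>In a chart, let the matrix \<open>L\<close> represent \<open>X\<close> and let \<open>z\<close> represent \<open>Z\<close>.  Then
  \<open>Y Z = L\<^sup>T (L L\<^sup>T)\<^sup>-\<^sup>1 z\<close>, and the inverse is smooth by Cramer's rule.\<close>

lemma smooth_map_Y:
  assumes Z: "smooth_vector_field \<A> Z"
  shows "smooth_map \<A> (\<lambda>x. Y x (Z x))"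
  unfolding smooth_map_def
proof
  fix c assume c: "c \<in> \<A>"
  let ?S = "chart_map c ` chart_dom c"
  define L :: "real ^ 'n \<Rightarrow> real ^ 'm ^ 'n" where
    "L = (\<lambda>p. matrix (\<lambda>e. X (chart_inv c p) e c))"
  define G where "G = (\<lambda>p. L p ** transpose (L p))"
  define z where "z = (\<lambda>p. Z (chart_inv c p) c)"
  define u where "u = (\<lambda>p. matrix_inv (G p) *v z p)"
  note S = open_chart_image[OF c]
  have inv: "chart_inv c p \<in> carrier_set \<A> \<and> c \<in> charts_at \<A> (chart_inv c p)" if "p \<in> ?S" for p
    using that c by (auto simp: charts_at_def chart_inv_map chart_dom_carrier)
  have L: "L p *v e = X (chart_inv c p) e c" if "p \<in> ?S" for p e
  proof -
    have "linear (\<lambda>e. X (chart_inv c p) e c)"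
      using linear_compose[OF linear_X chart_eval_linear] inv[OF that] by (simp add: o_def)
    then show ?thesis by (simp add: L_def matrix_works)
  qed
  \<comment> \<open>Every coordinate vector belongs to some tangent vector, so surjectivity onto the
    tangent space becomes surjectivity of the matrix.\<close>
  have "surj ((*v) (L p))" if p: "p \<in> ?S" for p
  proof -
    have "\<exists>e. L p *v e = w" for w
    proof -
    obtain v where "v \<in> tangent_space \<A> (chart_inv c p)" "v c = w"
      using tangent_space_coordinates inv[OF p] by blast
    moreover then obtain e where "v = X (chart_inv c p) e"
      using range_X inv[OF p] by blast
    ultimately show ?thesis using L[OF p] by metis
    qed
    then show ?thesis unfolding surj_def by metis
  qed
  then have det: "det (G p) \<noteq> 0" if "p \<in> ?S" for p
    unfolding G_def using that det_surj_gram_nonzero by blast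
  have Gu: "G p *v u p = z p" if "p \<in> ?S" for p
  proof -
    have "invertible (G p)" using det[OF that] invertible_det_nz by blast
    then have "G p ** matrix_inv (G p) = mat 1"
      unfolding invertible_def matrix_inv_def by (rule someI_ex[THEN conjunct1])
    then show ?thesis by (simp add: u_def matrix_vector_mul_assoc)
  qed
  have L_smooth: "smooth_on ?S (\<lambda>p. L p $ i $ j)" for i j
  proof -
    have "smooth_on ?S (\<lambda>p. X (chart_inv c p) (axis j 1) c $ i)"
      using smooth_vector_field_X[of "axis j 1"] c
      by (intro smooth_on_bounded_linear[OF S bounded_linear_vec_nth])
        (auto simp: smooth_vector_field_def)
    then show ?thesis by (simp add: L_def matrix_def)
  qed
  have "smooth_on ?S u"
  proof (rule smooth_on_linear_solution[OF S _ _ det Gu])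
    fix i j
    show "smooth_on ?S (\<lambda>p. G p $ i $ j)"
      unfolding G_def matrix_matrix_mult_def transpose_def
      by (simp, intro smooth_on_sum[OF S] smooth_on_bilinear[OF S bounded_bilinear_mult] L_smooth)
    show "smooth_on ?S z"
      using Z c by (simp add: z_def smooth_vector_field_def)
  qed
  then have u_smooth: "smooth_on ?S (\<lambda>p. u p $ i)" for i
    by (rule smooth_on_bounded_linear[OF S bounded_linear_vec_nth])
  have "smooth_on ?S (\<lambda>p. transpose (L p) *v u p)"
  proof (rule smooth_on_vec[OF S])
    fix j
    show "smooth_on ?S (\<lambda>p. (transpose (L p) *v u p) $ j)"
      unfolding matrix_vector_mult_def transpose_def
      by (simp, intro smooth_on_sum[OF S] smooth_on_bilinear[OF S bounded_bilinear_mult]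
          L_smooth u_smooth)
  qed
  then show "smooth_on ?S ((\<lambda>x. Y x (Z x)) \<circ> chart_inv c)"
  proof (rule smooth_on_cong[OF S])
    fix p assume p: "p \<in> ?S"
    define x where "x = chart_inv c p"
    have x: "x \<in> carrier_set \<A>" "c \<in> charts_at \<A> x" using inv[OF p] by (auto simp: x_def)
    let ?y = "transpose (L p) *v u p"
    \<comment> \<open>A vector in the range of the transpose is orthogonal to the kernel. Its image
      under \<open>X x\<close> equals \<open>Z x\<close> in the chart \<open>c\<close>, which
      determines a tangent vector.\<close>
    have "Y x (Z x) = ?y"
    proof (rule Y_eqI[OF x(1)])
      have "e \<bullet> ?y = 0" if "X x e = 0" for e
      proof -
        have "L p *v e = 0" using that L[OF p] by (simp add: x_def)
        then have "(transpose (L p) *v u p) \<bullet> e = 0"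
          by (simp add: dot_lmul_matrix transpose_matrix_vector)
        then show ?thesis by (simp add: inner_commute)
      qed
      then show "?y \<in> ker_perp X x"
        by (auto simp: ker_perp_def orthogonal_comp_def orthogonal_def)
      have "X x ?y c = G p *v u p"
        using L[OF p] by (simp add: x_def G_def matrix_vector_mul_assoc[symmetric])
      then have "X x ?y c = Z x c"
        using Gu[OF p] by (simp add: z_def x_def)
      then show "X x ?y = Z x"
        by (intro tangent_space_ext[OF X_tangent[OF x(1)] smooth_vector_field_tangent[OF Z x(1)] x(2)])
    qed
    then show "?y = ((\<lambda>x. Y x (Z x)) \<circ> chart_inv c) p" by (simp add: x_def)
  qed
qed

section \<open>The connection\<close>

lemma breve_nabla_eq:
  assumes "smooth_vector_field \<A> Z" "x \<in> carrier_set \<A>"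
  shows "breve_nabla \<A> X Z x v = X x (differential \<A> (\<lambda>y. Y y (Z y)) x v)"
proof -
  have "differential \<A> (\<lambda>y. Y y (Z y)) x v =
      differential \<A> (\<lambda>y. adjoint_coefficient X y (Z y)) x v"
    using assms by (intro differential_cong smooth_map_Y)
      (simp_all add: adjoint_coefficient_eq_Y smooth_vector_field_tangent)
  then show ?thesis by (simp add: breve_nabla_def)
qed

lemma X_expansion:
  assumes "x \<in> carrier_set \<A>"
  shows "(\<Sum>i\<in>UNIV. w $ i *\<^sub>R X x (axis i 1)) = X x w"
proof -
  note lin = linear_X[OF assms]
  have "X x (\<Sum>i\<in>UNIV. w $ i *\<^sub>R axis i 1) = (\<Sum>i\<in>UNIV. w $ i *\<^sub>R X x (axis i 1))"
    by (simp only: linear_sum[OF lin] linear_scale[OF lin])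
  then show ?thesis by (simp only: basis_scaleR_expansion)
qed

text \<open>\<open>smooth_coefficient\<close> speaks of constant arguments; a varying
  \<open>w\<close> is handled through its coordinates.\<close>

lemma smooth_vector_field_X_map:
  assumes "smooth_map \<A> w"
  shows "smooth_vector_field \<A> (\<lambda>x. X x (w x))"
proof (rule smooth_vector_field_cong)
  show "smooth_vector_field \<A> (\<lambda>x. \<Sum>i\<in>UNIV. w x $ i *\<^sub>R X x (axis i 1))"
    by (intro smooth_vector_field_sum smooth_vector_field_scale smooth_vector_field_X
        smooth_map_component assms)
qed (rule X_expansion)

text \<open>\<open>breve_nabla\<close> cut off to 0 at meaningless arguments, as the last clause of
  \<open>affine_connection\<close> demands, so that uniqueness can hold as an equality of
  functions.\<close>

definition breve_covder :: "('a, 'n) covder" where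
  "breve_covder Z x v =
    (if smooth_vector_field \<A> Z \<and> x \<in> carrier_set \<A> \<and> v \<in> tangent_space \<A> x
     then breve_nabla \<A> X Z x v else 0)"

lemma breve_covder_eq:
  assumes "smooth_vector_field \<A> Z" "x \<in> carrier_set \<A>" "v \<in> tangent_space \<A> x"
  shows "breve_covder Z x v = X x (differential \<A> (\<lambda>y. Y y (Z y)) x v)"
  using assms by (simp add: breve_covder_def breve_nabla_eq)

text \<open>Fibrewise linearity of \<open>Y\<close> and the rules for \<open>differential\<close>
  give the axioms after applying the linear map \<open>X x\<close>.\<close>

lemma affine_connection_breve_covder: "affine_connection \<A> breve_covder"
  unfolding affine_connection_def
proof (intro conjI allI impI; (elim conjE)?)
  fix Z x v
  assume Z: "smooth_vector_field \<A> Z" and x: "x \<in> carrier_set \<A>" and v: "v \<in> tangent_space \<A> x"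
  show "breve_covder Z x v \<in> tangent_space \<A> x"
    by (simp add: breve_covder_eq[OF Z x v] X_tangent[OF x])
next
  fix Z x u v and a b :: real
  assume Z: "smooth_vector_field \<A> Z" and x: "x \<in> carrier_set \<A>"
    and u: "u \<in> tangent_space \<A> x" and v: "v \<in> tangent_space \<A> x"
  have uv: "a *\<^sub>R u + b *\<^sub>R v \<in> tangent_space \<A> x"
    by (intro subspace_add subspace_scale subspace_tangent_space u v)
  show "breve_covder Z x (a *\<^sub>R u + b *\<^sub>R v) = a *\<^sub>R breve_covder Z x u + b *\<^sub>R breve_covder Z x v"
    by (simp only: breve_covder_eq[OF Z x] u v uv differential_linear[OF smooth_map_Y[OF Z] x]
        linear_add[OF linear_X[OF x]] linear_scale[OF linear_X[OF x]])
next
  fix Z W x v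
  assume Z: "smooth_vector_field \<A> Z" and W: "smooth_vector_field \<A> W"
    and x: "x \<in> carrier_set \<A>" and v: "v \<in> tangent_space \<A> x"
  note ZW = smooth_vector_field_add[OF Z W]
  have "differential \<A> (\<lambda>y. Y y (Z y + W y)) x v = differential \<A> (\<lambda>y. Y y (Z y) + Y y (W y)) x v"
  proof (rule differential_cong[OF smooth_map_Y[OF ZW] x])
    fix y assume y: "y \<in> carrier_set \<A>"
    show "Y y (Z y + W y) = Y y (Z y) + Y y (W y)"
      using Y_linear[OF y smooth_vector_field_tangent[OF Z y] smooth_vector_field_tangent[OF W y],
          of 1 1]
      by (simp only: scaleR_one)
  qed
  also have "\<dots> = differential \<A> (\<lambda>y. Y y (Z y)) x v + differential \<A> (\<lambda>y. Y y (W y)) x v"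
    by (rule differential_add[OF smooth_map_Y[OF Z] smooth_map_Y[OF W] x v])
  finally show "breve_covder (\<lambda>y. Z y + W y) x v = breve_covder Z x v + breve_covder W x v"
    by (simp only: breve_covder_eq[OF Z x v] breve_covder_eq[OF W x v] breve_covder_eq[OF ZW x v]
        linear_add[OF linear_X[OF x]])
next
  fix f :: "'a \<Rightarrow> real" and Z x v
  assume f: "smooth_map \<A> f" and Z: "smooth_vector_field \<A> Z"
    and x: "x \<in> carrier_set \<A>" and v: "v \<in> tangent_space \<A> x"
  note fZ = smooth_vector_field_scale[OF f Z]
  have "differential \<A> (\<lambda>y. Y y (f y *\<^sub>R Z y)) x v = differential \<A> (\<lambda>y. f y *\<^sub>R Y y (Z y)) x v"
  proof (rule differential_cong[OF smooth_map_Y[OF fZ] x])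
    fix y assume y: "y \<in> carrier_set \<A>"
    show "Y y (f y *\<^sub>R Z y) = f y *\<^sub>R Y y (Z y)"
      using Y_linear[OF y smooth_vector_field_tangent[OF Z y] smooth_vector_field_tangent[OF Z y],
          of "f y" 0]
      by (simp only: scaleR_zero_left add_0_right)
  qed
  \<comment> \<open>Under \<open>X x\<close> the second summand becomes the Leibniz term, because
    \<open>X x\<close> sends \<open>Y x (Z x)\<close> back to \<open>Z x\<close>.\<close>
  also have "\<dots> = f x *\<^sub>R differential \<A> (\<lambda>y. Y y (Z y)) x v + differential \<A> f x v *\<^sub>R Y x (Z x)"
    by (rule differential_bilinear[OF bounded_bilinear_scaleR f smooth_map_Y[OF Z] x v])
  finally show "breve_covder (\<lambda>y. f y *\<^sub>R Z y) x v =
      differential \<A> f x v *\<^sub>R Z x + f x *\<^sub>R breve_covder Z x v"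
    by (simp only: breve_covder_eq[OF Z x v] breve_covder_eq[OF fZ x v] add.commute
        linear_add[OF linear_X[OF x]] linear_scale[OF linear_X[OF x]]
        Y_in_ker_perp_and_X_Y(2)[OF x smooth_vector_field_tangent[OF Z x]])
next
  fix Z V assume Z: "smooth_vector_field \<A> Z" and V: "smooth_vector_field \<A> V"
  show "smooth_vector_field \<A> (\<lambda>x. breve_covder Z x (V x))"
  proof (rule smooth_vector_field_cong)
    show "smooth_vector_field \<A> (\<lambda>x. X x (differential \<A> (\<lambda>y. Y y (Z y)) x (V x)))"
      by (intro smooth_vector_field_X_map smooth_map_differential smooth_map_Y Z V)
  qed (simp add: breve_covder_eq[OF Z] smooth_vector_field_tangent[OF V])
qed (simp only: breve_covder_def if_False)

text \<open>Each equation is \<open>ker_perp_inner_Y_X\<close> with one of the two projected vectors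
  in the role of \<open>p\<close>.\<close>

lemma Y_X_projection:
  assumes x: "x \<in> carrier_set \<A>"
  shows "Y x (X x e) \<bullet> Y x (X x k) = e \<bullet> Y x (X x k)"
    "Y x (X x e) \<bullet> Y x (X x k) = Y x (X x e) \<bullet> k"
  using ker_perp_inner_Y_X[OF x Y_in_ker_perp_and_X_Y(1)[OF x X_tangent[OF x]]]
  by (metis inner_commute)+

text \<open>With \<open>Q y = Y y \<circ> X y\<close> the orthogonal projection onto \<open>ker_perp X y\<close>, differentiate
  \<open>Q e \<bullet> Q k = e \<bullet> Q k\<close> at a point where \<open>Q e = e\<close> and \<open>Q k = k\<close>: what remains is
  \<open>dQ e \<bullet> k = 0\<close>, so \<open>dQ e\<close> lies in the kernel of \<open>X\<close>.\<close>

lemma adapted_connection_breve_covder: "adapted_connection \<A> X breve_covder"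
  unfolding adapted_connection_def
proof (intro conjI ballI affine_connection_breve_covder)
  fix x v e assume x: "x \<in> carrier_set \<A>" and v: "v \<in> tangent_space \<A> x" and e: "e \<in> ker_perp X x"
  let ?Q = "\<lambda>k y. Y y (X y k)"
  let ?d = "\<lambda>k. differential \<A> (?Q k) x v"
  have Q: "smooth_map \<A> (?Q k)" for k
    by (rule smooth_map_Y[OF smooth_vector_field_X])
  have "?d e \<bullet> k = 0" if k: "k \<in> ker_perp X x" for k
  proof -
    have "differential \<A> (\<lambda>y. ?Q e y \<bullet> ?Q k y) x v = differential \<A> (\<lambda>y. e \<bullet> ?Q k y) x v"
      by (rule differential_cong[OF smooth_map_bilinear[OF bounded_bilinear_inner Q Q] x])
        (rule Y_X_projection)
    moreover have "?Q e x = e" "?Q k x = k"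
      using e k by (auto intro: Y_eqI[OF x])
    ultimately show ?thesis
      using differential_bilinear[OF bounded_bilinear_inner Q Q x v, of e k]
        differential_bounded_linear[OF bounded_linear_inner_right Q x v, of e k]
      by simp
  qed
  then have "?d e \<in> (ker_perp X x)\<^sup>\<bottom>"
    by (auto simp: orthogonal_comp_def orthogonal_def inner_commute)
  \<comment> \<open>The double orthogonal complement of the kernel, a subspace, is the kernel
    itself.\<close>
  then have "?d e \<in> {e. X x e = 0}"
    by (simp only: ker_perp_def orthogonal_comp_self[OF subspace_kernel_X[OF x]])
  then show "breve_covder (\<lambda>y. X y e) x v = 0"
    by (simp add: breve_covder_eq[OF smooth_vector_field_X x v])
qed

section \<open>Uniqueness of the adapted connection\<close>

lemma adapted_connection_eq:
  assumes D: "adapted_connection \<A> X D" and Z: "smooth_vector_field \<A> Z"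
    and x: "x \<in> carrier_set \<A>" and v: "v \<in> tangent_space \<A> x"
  shows "D Z x v = X x (differential \<A> (\<lambda>y. Y y (Z y)) x v)"
proof -
  let ?F = "\<lambda>y. Y y (Z y)" and ?E = "\<lambda>i y. X y (axis i 1)"
  have D': "affine_connection \<A> D" and D0: "\<And>e. e \<in> ker_perp X x \<Longrightarrow> D (\<lambda>y. X y e) x v = 0"
    using D x v by (auto simp: adapted_connection_def)
  note F = smooth_map_Y[OF Z]
  have FZ: "X y (?F y) = Z y" if "y \<in> carrier_set \<A>" for y
    by (rule Y_in_ker_perp_and_X_Y(2)[OF that smooth_vector_field_tangent[OF Z that]])
  \<comment> \<open>With coefficients frozen at \<open>x\<close>, the sum is the field
    \<open>X\<close> at the constant argument \<open>?F x\<close>, which lies in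
    \<open>ker_perp X x\<close>.\<close>
  have "D (\<lambda>y. \<Sum>i\<in>UNIV. ?F x $ i *\<^sub>R ?E i y) x v =
      (\<Sum>i\<in>UNIV. differential \<A> (\<lambda>y. ?F x $ i) x v *\<^sub>R ?E i x) +
      (\<Sum>i\<in>UNIV. ?F x $ i *\<^sub>R D (?E i) x v)"
    by (rule affine_connection_sum_scale[OF D' finite smooth_map_const smooth_vector_field_X x v])
  also have "\<dots> = (\<Sum>i\<in>UNIV. ?F x $ i *\<^sub>R D (?E i) x v)"
    by (simp only: differential_const[OF x] scaleR_zero_left sum.neutral_const add_0)
  \<comment> \<open>This equation and the next rewrite the left-hand side of the chain, which
    therefore ends with 0 on the left.\<close>
  also have "D (\<lambda>y. \<Sum>i\<in>UNIV. ?F x $ i *\<^sub>R ?E i y) x v = D (\<lambda>y. X y (?F x)) x v"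
    by (intro affine_connection_cong[OF D' _ _ x v] X_expansion smooth_vector_field_sum
        smooth_vector_field_scale smooth_map_const smooth_vector_field_X)
  also have "\<dots> = 0"
    by (rule D0[OF Y_in_ker_perp_and_X_Y(1)[OF x smooth_vector_field_tangent[OF Z x]]])
  finally have frozen: "(\<Sum>i\<in>UNIV. ?F x $ i *\<^sub>R D (?E i) x v) = 0" ..
  \<comment> \<open>The expansion of \<open>Z\<close> holds at points of the manifold, so
    \<open>affine_connection_cong\<close> is needed to replace one field by the other.\<close>
  have "D Z x v = D (\<lambda>y. \<Sum>i\<in>UNIV. ?F y $ i *\<^sub>R ?E i y) x v"
  proof (rule affine_connection_cong[OF D' Z _ x v])
    show "smooth_vector_field \<A> (\<lambda>y. \<Sum>i\<in>UNIV. ?F y $ i *\<^sub>R ?E i y)"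
      by (intro smooth_vector_field_sum smooth_vector_field_scale smooth_vector_field_X
          smooth_map_component F)
  qed (simp only: X_expansion FZ)
  also have "\<dots> = (\<Sum>i\<in>UNIV. differential \<A> (\<lambda>y. ?F y $ i) x v *\<^sub>R ?E i x)"
    by (simp only: affine_connection_sum_scale[OF D' finite smooth_map_component[OF F]
          smooth_vector_field_X x v] frozen add_0_right)
  also have "\<dots> = X x (differential \<A> ?F x v)"
    by (simp only: differential_bounded_linear[OF bounded_linear_vec_nth F x v] X_expansion[OF x])
  finally show ?thesis .
qed

text \<open>Meaningful arguments are settled by the formula, all others by the default value 0 on
  both sides.\<close>

lemma adapted_connection_unique:
  assumes "adapted_connection \<A> X D"
  shows "D = breve_covder"
proof (intro ext)
  fix Z x v
  show "D Z x v c = breve_covder Z x v c" for c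
  proof (cases "smooth_vector_field \<A> Z \<and> x \<in> carrier_set \<A> \<and> v \<in> tangent_space \<A> x")
    case True
    then show ?thesis by (simp add: adapted_connection_eq[OF assms] breve_covder_eq)
  next
    case False
    then have "D Z x v = 0"
      using assms unfolding adapted_connection_def affine_connection_def by blast
    then show ?thesis using False by (simp only: breve_covder_def if_False)
  qed
qed

section \<open>Compatibility with the induced metric\<close>

lemma riemannian_metric_induced: "riemannian_metric \<A> (induced_metric X)"
  unfolding riemannian_metric_def induced_metric_def
proof (intro conjI ballI allI impI; (elim conjE)?)
  fix x u v w and a b :: real
  assume "x \<in> carrier_set \<A>" "u \<in> tangent_space \<A> x" "v \<in> tangent_space \<A> x"
  then show "Y x (a *\<^sub>R u + b *\<^sub>R v) \<bullet> Y x w = a * (Y x u \<bullet> Y x w) + b * (Y x v \<bullet> Y x w)"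
    by (simp only: Y_linear inner_add_left inner_scaleR_left)
next
  fix x u assume x: "x \<in> carrier_set \<A>" and u: "u \<in> tangent_space \<A> x" "u \<noteq> 0"
  \<comment> \<open>\<open>Y x\<close> is injective on tangent vectors, having \<open>X x\<close> as
    a left inverse.\<close>
  have "Y x u \<noteq> 0"
    using Y_in_ker_perp_and_X_Y(2)[OF x u(1)] u(2) linear_0[OF linear_X[OF x]] by metis
  then show "0 < Y x u \<bullet> Y x u" by simp
next
  fix Z W assume "smooth_vector_field \<A> Z" "smooth_vector_field \<A> W"
  then show "smooth_map \<A> (\<lambda>x. Y x (Z x) \<bullet> Y x (W x))"
    by (intro smooth_map_bilinear[OF bounded_bilinear_inner] smooth_map_Y)
qed (rule inner_commute)

text \<open>Differentiating the inner product of \<open>Y Z\<close> and \<open>Y W\<close> gives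
  terms with the differentials of \<open>Y Z\<close> and \<open>Y W\<close>, which may leave
  \<open>ker_perp X x\<close>. Applying \<open>Y x\<close> to the covariant derivative projects them
  back, and pairing with a vector of \<open>ker_perp X x\<close> does not see the
  projection.\<close>

lemma metric_connection_breve_covder: "metric_connection \<A> (induced_metric X) breve_covder"
  unfolding metric_connection_def
proof (intro conjI allI impI riemannian_metric_induced affine_connection_breve_covder; elim conjE)
  fix Z W x v
  assume Z: "smooth_vector_field \<A> Z" and W: "smooth_vector_field \<A> W"
    and x: "x \<in> carrier_set \<A>" and v: "v \<in> tangent_space \<A> x"
  have *: "Y x (V x) \<bullet> Y x (X x e) = Y x (V x) \<bullet> e" if "smooth_vector_field \<A> V" for V e
    using Y_in_ker_perp_and_X_Y(1)[OF x smooth_vector_field_tangent[OF that x]]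
    by (rule ker_perp_inner_Y_X[OF x])
  show "differential \<A> (\<lambda>y. induced_metric X y (Z y) (W y)) x v =
      induced_metric X x (breve_covder Z x v) (W x) + induced_metric X x (Z x) (breve_covder W x v)"
    using differential_bilinear[OF bounded_bilinear_inner smooth_map_Y[OF Z] smooth_map_Y[OF W] x v]
    by (simp add: induced_metric_def breve_covder_eq[OF Z x v] breve_covder_eq[OF W x v] *[OF Z]
        inner_commute[of _ "Y x (W x)"] *[OF W])
qed

end

theorem theorem1p1:
  fixes M :: "'a topology"
    and \<A> :: "('a, 'n::finite) chart set"
    and X :: "'a \<Rightarrow> real ^ 'm::finite \<Rightarrow> ('a, 'n) tvec"
    and A :: "'a \<Rightarrow> ('a, 'n) tvec"
    and P :: "'w measure"
    and B :: "real \<Rightarrow> 'w \<Rightarrow> real ^ 'm"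
  assumes "smooth_manifold M \<A>"
    and "nondegenerate_sde \<A> X A P B"
  shows "(\<exists>!D. adapted_connection \<A> X D) \<and>
    (\<forall>D. adapted_connection \<A> X D \<longrightarrow>
       (\<forall>Z. smooth_vector_field \<A> Z \<longrightarrow>
          (\<forall>x\<in>topspace M. \<forall>v\<in>tangent_space \<A> x. D Z x v = breve_nabla \<A> X Z x v)) \<and>
       metric_connection \<A> (induced_metric X) D)"
proof -
  interpret smooth_frame M \<A> X
    using assms by unfold_locales (auto simp: nondegenerate_sde_def)
  show ?thesis
  proof (intro conjI allI impI ballI ex1I[of _ breve_covder] adapted_connection_breve_covder)
    fix D assume D: "adapted_connection \<A> X D"
    show "D = breve_covder" by (rule adapted_connection_unique[OF D])
    show "metric_connection \<A> (induced_metric X) D"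
      unfolding adapted_connection_unique[OF D] by (rule metric_connection_breve_covder)
    fix Z x v
    assume "smooth_vector_field \<A> Z" "x \<in> topspace M" "v \<in> tangent_space \<A> x"
    then show "D Z x v = breve_nabla \<A> X Z x v"
      by (simp add: adapted_connection_eq[OF D] breve_nabla_eq carrier_topspace)
  qed
qed

end
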